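(* Let $\delta_1,\dots,\delta_4$ and $\phi_1,\dots,\phi_4$ be real numbers such that $\delta_i>0$ for all $i=1,\dots,4$ and $1+\phi_1+\phi_2+\phi_3+2\phi_4=0$. Put $\delta_0=1$, $\delta_5=\delta_4$, $\phi_0=1$, $\phi_5=\phi_4$, and assume that $\phi_4/\delta_4\neq\phi_i/\delta_i$ for some $i\in\{1,2,3\}$. Then there exist real matrices $$B_0=I_2,\quad B_i=\begin{bmatrix} r_i&s_i\\ s_i&u_i\end{bmatrix}\ (i=1,2,3),\quad B_4=\begin{bmatrix} r_4&s_4\\ t_4&u_4\end{bmatrix},\quad B_5:=B_4^{\top}$$ such that $\mathbf{B}=\{b_i:=(\delta_i,\phi_i,B_i)\mid 0\le i\le5\}$ is a standard RBA$^{\delta}$-basis of $A=\mathbb{R}\oplus\mathbb{R}\oplus M_2(\mathbb{R})$ with respect to the involution $(x,y,Z)^*=(x,y,Z^{\top})$ and the degree map $\delta((x,y,Z))=x$. Furthermore, the matrices $B_0,B_1,\dots,B_5$ are unique up to conjugation by an orthogonal $2\times2$ matrix and a permutation of the indices of the $B_i$ by an element of the group $\langle(1,2),(1,2,3)\rangle\times\langle(4,5)\rangle$; that is, if $(B_i)$ and $(B_i')$ are two such families, then there are an orthogonal $2\times 2$ matrix $O$ and an element $\pi$ of this group such that $B_i'=OB_{\pi(i)}O^{-1}$ for all $i=0,\dots,5$.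
   Context: An RBA-basis of a finite-dimensional algebra with involution $*$ is a basis $\mathbf{B}=\{b_0,\dots,b_{r-1}\}$ such that: (1) $b_0$ is the identity; (2) the structure constants $\lambda_{ijk}$ in $b_ib_j=\sum_k\lambda_{ijk}b_k$ are real; (3) $\mathbf{B}^*=\mathbf{B}$, and one writes $b_{i^*}=(b_i)^*$; (4) $\lambda_{ij0}\ne0$ if and only if $j=i^*$; (5) $\lambda_{ii^*0}=\lambda_{i^*i0}>0$. (Reality-based algebras are defined over $\mathbb{C}$ with conjugate-semilinear involution; here one works with the real span $\mathbb{R}\mathbf{B}$, i.e. a basis of the real algebra $A$ is regarded as a basis of $A\otimes_{\mathbb{R}}\mathbb{C}$ with $*$ extended conjugate-linearly.) It is an RBA$^{\delta}$-basis if $\delta$ is a one-dimensional algebra homomorphism with $\delta(a^* )=\overline{\delta(a)}$ for all $a$ and $\delta(b_i)>0$ for all $i$ (a positive degree map); it is standard if moreover $\delta(b_i)=\lambda_{ii^*0}$ for all $i$. *)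

theory Defs
  imports
    "HOL-Analysis.Analysis"
    "HOL-Algebra.Sym_Groups"
    "HOL-Library.Complex_Order"
begin

section \<open>Reality-based algebras\<close>

locale star_algebra = vector_space scale
  for scale :: "complex \<Rightarrow> 'v::ab_group_add \<Rightarrow> 'v" +
  fixes mul :: "'v \<Rightarrow> 'v \<Rightarrow> 'v" and unit :: 'v and star :: "'v \<Rightarrow> 'v"
  assumes mul_add_left: "mul (x + y) z = mul x z + mul y z"
    and mul_add_right: "mul x (y + z) = mul x y + mul x z"
    and mul_scale_left: "mul (scale c x) y = scale c (mul x y)"
    and mul_scale_right: "mul x (scale c y) = scale c (mul x y)"
    and mul_assoc: "mul (mul x y) z = mul x (mul y z)"
    and unit_left: "mul unit x = x"
    and unit_right: "mul x unit = x"
    and star_add: "star (x + y) = star x + star y"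
    and star_scale: "star (scale c x) = scale (cnj c) (star x)"
    and star_mul: "star (mul x y) = mul (star y) (star x)"
    and star_star: "star (star x) = x"
begin

definition is_basis :: "nat \<Rightarrow> (nat \<Rightarrow> 'v) \<Rightarrow> bool" where
  "is_basis r b \<longleftrightarrow>
     inj_on b {..<r} \<and> independent (b ` {..<r}) \<and> span (b ` {..<r}) = UNIV"

text \<open>\<open>struct_const r b i j k\<close> is the coefficient of \<open>b k\<close> in \<open>mul (b i) (b j)\<close>.\<close>
definition struct_const :: "nat \<Rightarrow> (nat \<Rightarrow> 'v) \<Rightarrow> nat \<Rightarrow> nat \<Rightarrow> nat \<Rightarrow> complex" where
  "struct_const r b i j k = representation (b ` {..<r}) (mul (b i) (b j)) (b k)"

definition star_index :: "nat \<Rightarrow> (nat \<Rightarrow> 'v) \<Rightarrow> nat \<Rightarrow> nat" where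
  "star_index r b i = (THE j. j < r \<and> b j = star (b i))"

end

text \<open>
  Order relations on \<open>complex\<close> are those of \<open>Complex_Order\<close>: \<open>0 < z\<close> means that \<open>z\<close> is
  real and positive.
\<close>

locale rba_basis = star_algebra scale mul unit star
  for scale :: "complex \<Rightarrow> 'v::ab_group_add \<Rightarrow> 'v" and mul unit star +
  fixes r :: nat and b :: "nat \<Rightarrow> 'v"
  assumes r_pos: "0 < r"
    and basis: "is_basis r b"
    and b_0: "b 0 = unit"
    and struct_const_real:
      "\<lbrakk>i < r; j < r; k < r\<rbrakk> \<Longrightarrow> struct_const r b i j k \<in> \<real>"
    and star_closed: "star ` b ` {..<r} = b ` {..<r}"
    and struct_const_0_iff:
      "\<lbrakk>i < r; j < r\<rbrakk> \<Longrightarrow> struct_const r b i j 0 \<noteq> 0 \<longleftrightarrow> j = star_index r b i"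
    and struct_const_0_sym:
      "i < r \<Longrightarrow> struct_const r b i (star_index r b i) 0 = struct_const r b (star_index r b i) i 0"
    and struct_const_0_pos:
      "i < r \<Longrightarrow> struct_const r b i (star_index r b i) 0 > 0"

locale rba_delta_basis = rba_basis scale mul unit star r b
  for scale :: "complex \<Rightarrow> 'v::ab_group_add \<Rightarrow> 'v" and mul unit star r b +
  fixes deg :: "'v \<Rightarrow> complex"
  assumes deg_add: "deg (x + y) = deg x + deg y"
    and deg_scale: "deg (scale c x) = c * deg x"
    and deg_mul: "deg (mul x y) = deg x * deg y"
    and deg_unit: "deg unit = 1"
    and deg_star: "deg (star x) = cnj (deg x)"
    and deg_pos: "i < r \<Longrightarrow> deg (b i) > 0"

locale standard_rba_delta_basis = rba_delta_basis scale mul unit star r b deg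
  for scale :: "complex \<Rightarrow> 'v::ab_group_add \<Rightarrow> 'v" and mul unit star r b deg +
  assumes standard: "i < r \<Longrightarrow> deg (b i) = struct_const r b i (star_index r b i) 0"


section \<open>Complexification\<close>

text \<open>
  The complexification of a real algebra on the type \<open>'a\<close> is carried by \<open>'a \<times> 'a\<close>, where
  \<open>(x, y)\<close> stands for \<open>x \<otimes> 1 + y \<otimes> \<i>\<close>.
\<close>

definition cx_scale :: "complex \<Rightarrow> 'a::real_vector \<times> 'a \<Rightarrow> 'a \<times> 'a" where
  "cx_scale c = (\<lambda>(x, y). (Re c *\<^sub>R x - Im c *\<^sub>R y, Re c *\<^sub>R y + Im c *\<^sub>R x))"

definition cx_mul :: "('a::real_vector \<Rightarrow> 'a \<Rightarrow> 'a) \<Rightarrow> 'a \<times> 'a \<Rightarrow> 'a \<times> 'a \<Rightarrow> 'a \<times> 'a" where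
  "cx_mul m = (\<lambda>(x, y) (x', y'). (m x x' - m y y', m x y' + m y x'))"

text \<open>The conjugate-linear extension of a real-linear involution.\<close>
definition cx_star :: "('a::real_vector \<Rightarrow> 'a) \<Rightarrow> 'a \<times> 'a \<Rightarrow> 'a \<times> 'a" where
  "cx_star s = (\<lambda>(x, y). (s x, - s y))"

text \<open>The complex-linear extension of a real-linear functional.\<close>
definition cx_functional :: "('a::real_vector \<Rightarrow> real) \<Rightarrow> 'a \<times> 'a \<Rightarrow> complex" where
  "cx_functional f = (\<lambda>(x, y). Complex (f x) (f y))"

definition cx_embed :: "'a::real_vector \<Rightarrow> 'a \<times> 'a" where
  "cx_embed x = (x, 0)"

definition real_standard_rba_delta_basis ::
  "('a::real_vector \<Rightarrow> 'a \<Rightarrow> 'a) \<Rightarrow> 'a \<Rightarrow> ('a \<Rightarrow> 'a) \<Rightarrow> nat \<Rightarrow> (nat \<Rightarrow> 'a) \<Rightarrow> ('a \<Rightarrow> real) \<Rightarrow> bool"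
where
  "real_standard_rba_delta_basis m e s r b d \<longleftrightarrow>
     standard_rba_delta_basis cx_scale (cx_mul m) (cx_embed e) (cx_star s) r
       (\<lambda>i. cx_embed (b i)) (cx_functional d)"


section \<open>The algebra of triples\<close>

text \<open>
The product is spelled out because \<open>*\<close> on \<open>real^2^2\<close> is entrywise multiplication.
\<close>

type_synonym triple = "real \<times> real \<times> (real^2^2)"

definition triple_mul :: "triple \<Rightarrow> triple \<Rightarrow> triple" where
  "triple_mul = (\<lambda>(x, y, Z) (x', y', Z'). (x * x', y * y', Z ** Z'))"

definition triple_one :: triple where
  "triple_one = (1, 1, mat 1)"

definition triple_star :: "triple \<Rightarrow> triple" where
  "triple_star = (\<lambda>(x, y, Z). (x, y, Finite_Cartesian_Product.transpose Z))"

definition triple_deg :: "triple \<Rightarrow> real" where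
  "triple_deg = (\<lambda>(x, y, Z). x)"

definition mat2 :: "real \<Rightarrow> real \<Rightarrow> real \<Rightarrow> real \<Rightarrow> real^2^2" where
  "mat2 a b c d = vector [vector [a, b], vector [c, d]]"

definition rba_family :: "(nat \<Rightarrow> real) \<Rightarrow> (nat \<Rightarrow> real) \<Rightarrow> (nat \<Rightarrow> real^2^2) \<Rightarrow> bool" where
  "rba_family \<delta> \<phi> B \<longleftrightarrow>
     B 0 = mat 1 \<and>
     (\<forall>i\<in>{1,2,3}. \<exists>r s u. B i = mat2 r s s u) \<and>
     (\<exists>r s t u. B 4 = mat2 r s t u) \<and>
     B 5 = Finite_Cartesian_Product.transpose (B 4) \<and>
     real_standard_rba_delta_basis triple_mul triple_one triple_star 6
       (\<lambda>i. (\<delta> i, \<phi> i, B i)) triple_deg"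

text \<open>The group \<open>\<langle>(1,2), (1,2,3)\<rangle> \<times> \<langle>(4,5)\<rangle>\<close> as an internal direct product; its elements fix \<open>0\<close>.\<close>
definition index_perms :: "(nat \<Rightarrow> nat) set" where
  "index_perms =
     generate (sym_group 5) {cycle_of_list [1, 2], cycle_of_list [1, 2, 3]}
       <#>\<^bsub>sym_group 5\<^esub> generate (sym_group 5) {cycle_of_list [4, 5]}"

end

theory Submission
  imports Defs
begin

text \<open>
  The coefficient of \<open>b 0\<close> is a trace \<open>\<tau>\<close>, hence of the form
  \<open>\<tau> (x, y, Z) = x/n + y/m + c tr Z\<close>. Here \<open>n = \<Sum>\<delta> i\<close> and \<open>m = \<Sum>(\<phi> i)\<^sup>2 / \<delta> i\<close>, because
  \<open>\<Sum>b i\<close> and \<open>\<Sum>(\<phi> i / \<delta> i) b i\<close> represent the two one-dimensional characters, and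
  \<open>c = (1 - 1/n - 1/m)/2\<close>, which the assumption on the ratios makes positive. Being a standard basis
  means that the \<open>b i\<close> are \<open>\<tau>\<close>-orthogonal with \<open>\<tau> (b i b i\<^sup>*) = \<delta> i\<close>, so all inner products
  \<open>tr (B i (B j)\<^sup>T)\<close> are prescribed. The traceless symmetric parts of the \<open>B i\<close> lie in a plane, on
  which conjugation by orthogonal matrices acts as the full group of isometries fixing 0; this gives
  uniqueness, the sign of the skew part of \<open>B 4\<close> being absorbed by the swap of 4 and 5. Existence
  amounts to finding plane vectors with a given Gram matrix, namely that of a projection of rank 2.
\<close>

section \<open>Bases dual to a functional\<close>

text \<open>Evaluating \<open>f k\<close> on a linear combination isolates the coefficient of
  \<open>b k\<close>, so biorthogonality yields injectivity, independence and coordinates at once.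
  The general setting serves both the real algebra and its complexification.\<close>

lemma (in vector_space) dual_family_independent:
  fixes f :: "nat \<Rightarrow> 'b \<Rightarrow> 'a"
  assumes add: "\<And>k x y. f k (x + y) = f k x + f k y"
    and hom: "\<And>k c x. f k (scale c x) = c * f k x"
    and dual: "\<And>i k. \<lbrakk>i < r; k < r\<rbrakk> \<Longrightarrow> f k (b i) = (if i = k then 1 else 0)"
  shows "inj_on b {..<r}" and "independent (b ` {..<r})"
    and "\<lbrakk>v \<in> span (b ` {..<r}); k < r\<rbrakk> \<Longrightarrow> representation (b ` {..<r}) v (b k) = f k v"
proof -
  have zero: "f k 0 = 0" for k
    using hom[of k 0 0] by simp
  have sum: "f k (sum g A) = (\<Sum>i\<in>A. f k (g i))" if "finite A" for k g and A :: "'c set"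
    using that by (induction A) (simp_all add: zero add)
  show inj: "inj_on b {..<r}"
  proof (rule inj_onI)
    fix i j assume "i \<in> {..<r}" "j \<in> {..<r}" "b i = b j"
    then show "i = j"
      by (metis dual lessThan_iff zero_neq_one)
  qed
  have coeff: "f k (\<Sum>w\<in>b ` {..<r}. scale (u w) w) = u (b k)" if "k < r" for k u
  proof -
    have "f k (\<Sum>w\<in>b ` {..<r}. scale (u w) w) = (\<Sum>w\<in>b ` {..<r}. u w * f k w)"
      by (simp only: sum finite_imageI finite_lessThan hom)
    also have "\<dots> = (\<Sum>i<r. u (b i) * f k (b i))"
      using inj by (simp add: sum.reindex)
    also have "\<dots> = (\<Sum>i<r. if i = k then u (b k) else 0)"
      using that by (intro sum.cong) (auto simp: dual)
    finally show ?thesis using that by simp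
  qed
  show ind: "independent (b ` {..<r})"
  proof
    assume "dependent (b ` {..<r})"
    then obtain u k where k: "k < r" and u: "u (b k) \<noteq> 0"
        and eq: "(\<Sum>w\<in>b ` {..<r}. scale (u w) w) = 0"
      using dependent_finite[of "b ` {..<r}"] by auto
    with coeff[OF k, of u] show False
      by (simp add: zero)
  qed
  show "representation (b ` {..<r}) v (b k) = f k v" if v: "v \<in> span (b ` {..<r})" and k: "k < r"
  proof -
    have "(\<Sum>w\<in>b ` {..<r}. scale (representation (b ` {..<r}) v w) w) = v"
      by (rule sum_representation_eq) (use ind v in auto)
    with coeff[OF k, of "representation (b ` {..<r}) v"] show ?thesis
      by simp
  qed
qed

section \<open>Real algebras and their complexifications\<close>

lemma star_algebra_complexification:
  fixes m :: "'a::real_vector \<Rightarrow> 'a \<Rightarrow> 'a"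
  assumes m: "bilinear m" and assoc: "\<And>x y z. m (m x y) z = m x (m y z)"
    and unit: "\<And>x. m e x = x" "\<And>x. m x e = x"
    and s: "linear s" and s_mul: "\<And>x y. s (m x y) = m (s y) (s x)"
    and s_s: "\<And>x. s (s x) = x"
  shows "star_algebra cx_scale (cx_mul m) (cx_embed e) (cx_star s)"
proof -
  note bil = bilinear_ladd[OF m] bilinear_radd[OF m] bilinear_lmul[OF m] bilinear_rmul[OF m]
    bilinear_lsub[OF m] bilinear_rsub[OF m] bilinear_lneg[OF m] bilinear_rneg[OF m]
    bilinear_lzero[OF m] bilinear_rzero[OF m]
  note lin = linear_add[OF s] linear_scale[OF s] linear_diff[OF s] linear_neg[OF s]
  show ?thesis
  proof
    fix c c' :: complex and x y z :: "'a \<times> 'a"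
    show "cx_scale c (x + y) = cx_scale c x + cx_scale c y"
      and "cx_scale (c + c') x = cx_scale c x + cx_scale c' x"
      and "cx_scale c (cx_scale c' x) = cx_scale (c * c') x"
      and "cx_scale 1 x = x"
      by (simp_all add: cx_scale_def split_beta prod_eq_iff algebra_simps)
    show "cx_mul m (x + y) z = cx_mul m x z + cx_mul m y z"
      and "cx_mul m x (y + z) = cx_mul m x y + cx_mul m x z"
      by (simp_all add: cx_mul_def split_beta prod_eq_iff bil)
    show "cx_mul m (cx_scale c x) y = cx_scale c (cx_mul m x y)"
      and "cx_mul m x (cx_scale c y) = cx_scale c (cx_mul m x y)"
      by (simp_all add: cx_mul_def cx_scale_def split_beta prod_eq_iff bil algebra_simps)
    show "cx_mul m (cx_mul m x y) z = cx_mul m x (cx_mul m y z)"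
      by (simp add: cx_mul_def split_beta prod_eq_iff bil assoc)
    show "cx_mul m (cx_embed e) x = x" "cx_mul m x (cx_embed e) = x"
      by (simp_all add: cx_mul_def cx_embed_def split_beta bil unit)
    show "cx_star s (x + y) = cx_star s x + cx_star s y"
      and "cx_star s (cx_scale c x) = cx_scale (cnj c) (cx_star s x)"
      and "cx_star s (cx_star s x) = x"
      by (simp_all add: cx_star_def cx_scale_def split_beta prod_eq_iff lin s_s)
    show "cx_star s (cx_mul m x y) = cx_mul m (cx_star s y) (cx_star s x)"
      by (simp add: cx_star_def cx_mul_def split_beta prod_eq_iff lin bil s_mul)
  qed
qed

text \<open>The Gram relation makes \<open>\<tau> (m x (b (\<sigma> k))) / d (b k)\<close>, as a
  function of \<open>x\<close>, a dual family. This supplies independence and all coordinates, and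
  having \<open>DIM('a)\<close> members the family spans. For \<open>k = 0\<close> the functional is
  \<tau> itself, so coefficients of \<open>b 0\<close> are read off the Gram relation.\<close>

lemma real_standard_rba_delta_basisI:
  fixes m :: "'a::euclidean_space \<Rightarrow> 'a \<Rightarrow> 'a" and \<tau> d :: "'a \<Rightarrow> real"
  assumes m: "bilinear m" and assoc: "\<And>x y z. m (m x y) z = m x (m y z)"
    and unit: "\<And>x. m e x = x" "\<And>x. m x e = x"
    and s: "linear s" and s_mul: "\<And>x y. s (m x y) = m (s y) (s x)"
    and s_s: "\<And>x. s (s x) = x"
    and d: "linear d" "\<And>x y. d (m x y) = d x * d y" "d e = 1" "\<And>x. d (s x) = d x"
    and \<tau>: "linear \<tau>"
    and b_0: "b 0 = e" and d_pos: "\<And>i. i < DIM('a) \<Longrightarrow> d (b i) > 0"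
    and \<sigma>: "\<And>i. i < DIM('a) \<Longrightarrow> \<sigma> i < DIM('a)" "\<And>i. i < DIM('a) \<Longrightarrow> \<sigma> (\<sigma> i) = i" "\<sigma> 0 = 0"
    and s_b: "\<And>i. i < DIM('a) \<Longrightarrow> s (b i) = b (\<sigma> i)"
    and gram: "\<And>i j. \<lbrakk>i < DIM('a); j < DIM('a)\<rbrakk> \<Longrightarrow>
                 \<tau> (m (b i) (b j)) = (if j = \<sigma> i then d (b i) else 0)"
  shows "real_standard_rba_delta_basis m e s DIM('a) b d"
proof -
  define r where "r = DIM('a)"
  have r_pos: "0 < r" by (simp add: r_def)
  note d_pos = d_pos[folded r_def] and \<sigma> = \<sigma>[folded r_def] and s_b = s_b[folded r_def]
    and gram = gram[folded r_def]
  define f where "f k x = \<tau> (m x (b (\<sigma> k))) / d (b k)" for k x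
  have f: "linear (f k)" for k
    unfolding f_def
    by (rule linearI) (simp_all add: bilinear_ladd[OF m] bilinear_lmul[OF m] linear_add[OF \<tau>]
        linear_scale[OF \<tau>] add_divide_distrib)
  have \<sigma>_eq: "\<sigma> k = \<sigma> i \<longleftrightarrow> k = i" if "i < r" "k < r" for i k
    using \<sigma>(2) that by metis
  have dual: "f k (b i) = (if i = k then 1 else 0)" if "i < r" "k < r" for i k
    using that gram[of i "\<sigma> k"] \<sigma>(1)[of k] d_pos[of i] \<sigma>_eq[of i k]
    by (auto simp: f_def)
  have f_0: "f 0 x = \<tau> x" for x
    by (simp add: f_def \<sigma> b_0 unit d)
  note real_dual = real_vector.dual_family_independent[where f = f and b = b and r = r]
  have real_ind: "inj_on b {..<r}" "independent (b ` {..<r})"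
    using real_dual(1,2) f dual by (auto simp: linear_add linear_scale)
  have "card (b ` {..<r}) = r"
    using real_ind(1) by (simp add: card_image)
  then have real_span: "span (b ` {..<r}) = UNIV"
    using real_ind(2) card_eq_dim[of "b ` {..<r}" UNIV] by (auto simp: r_def)
  interpret star_algebra cx_scale "cx_mul m" "cx_embed e" "cx_star s"
    using m assoc unit s s_mul s_s by (rule star_algebra_complexification)
  let ?b = "\<lambda>i. cx_embed (b i)"
  have cf: "cx_functional g (x + y) = cx_functional g x + cx_functional g y"
    "cx_functional g (cx_scale c x) = c * cx_functional g x" if "linear g" for g :: "'a \<Rightarrow> real" and c x y
    using that by (auto simp: cx_functional_def cx_scale_def split_beta linear_add linear_diff
        linear_scale complex_eq_iff)
  have cx_dual: "cx_functional (f k) (?b i) = (if i = k then 1 else 0)" if "i < r" "k < r" for i k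
    using dual[OF that] f[THEN linear_0]
    by (simp add: cx_functional_def cx_embed_def complex_eq_iff)
  note cx_family = dual_family_independent[where f = "\<lambda>k. cx_functional (f k)" and b = ?b and r = r]
  have cx_ind: "inj_on ?b {..<r}" "independent (?b ` {..<r})"
    using cx_family(1,2) cf[OF f] cx_dual by blast+
  have embed_sum: "cx_embed (\<Sum>i<n. c i *\<^sub>R b i) = (\<Sum>i<n. cx_scale (of_real (c i)) (?b i))" for n c
    by (simp add: cx_embed_def cx_scale_def prod_eq_iff fst_sum snd_sum)
  have embed_span: "cx_embed x \<in> span (?b ` {..<r})" for x
  proof -
    have "x \<in> Real_Vector_Spaces.span (b ` {..<r})" using real_span by simp
    then obtain u where "x = (\<Sum>w\<in>b ` {..<r}. u w *\<^sub>R w)"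
      using real_vector.span_finite[of "b ` {..<r}"] by auto
    then have "x = (\<Sum>i<r. u (b i) *\<^sub>R b i)"
      using real_ind(1) by (simp add: sum.reindex)
    then have x: "cx_embed x = (\<Sum>i<r. cx_scale (of_real (u (b i))) (?b i))"
      by (simp only: embed_sum)
    show ?thesis
      unfolding x by (rule span_sum, rule span_scale, rule span_base) auto
  qed
  have cx_span: "span (?b ` {..<r}) = UNIV"
  proof -
    have "v = cx_embed (fst v) + cx_scale \<i> (cx_embed (snd v))" for v :: "'a \<times> 'a"
      by (simp add: cx_embed_def cx_scale_def prod_eq_iff)
    then have "v \<in> span (?b ` {..<r})" for v
      by (metis embed_span span_add span_scale)
    then show ?thesis by auto
  qed
  have rep: "representation (?b ` {..<r}) v (?b k) = cx_functional (f k) v" if "k < r" for v k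
    using cx_family(3)[of v k] cf[OF f] cx_dual that unfolding cx_span by blast
  have sc: "struct_const r ?b i j k = of_real (f k (m (b i) (b j)))" if "k < r" for i j k
    unfolding struct_const_def rep[OF that]
    using bilinear_lzero[OF m] bilinear_rzero[OF m] f[THEN linear_0]
    by (simp add: cx_mul_def cx_embed_def cx_functional_def complex_eq_iff)
  have sb: "cx_star s (?b i) = ?b (\<sigma> i)" if "i < r" for i
    using s_b that linear_0[OF s] by (simp add: cx_star_def cx_embed_def)
  have si: "star_index r ?b i = \<sigma> i" if "i < r" for i
    unfolding star_index_def
  proof (rule the_equality)
    show "\<sigma> i < r \<and> ?b (\<sigma> i) = cx_star s (?b i)" using sb \<sigma> that by auto
    fix j assume "j < r \<and> ?b j = cx_star s (?b i)"
    then show "j = \<sigma> i"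
      using cx_ind(1) \<sigma>(1)[OF that] sb[OF that] by (auto simp: inj_on_def)
  qed
  have sc0: "struct_const r ?b i j 0 = (if j = \<sigma> i then of_real (d (b i)) else 0)"
    if "i < r" "j < r" for i j
    using sc[OF r_pos] gram[OF that] by (simp add: f_0)
  have "standard_rba_delta_basis cx_scale (cx_mul m) (cx_embed e) (cx_star s) r ?b (cx_functional d)"
  proof unfold_locales
    show "is_basis r ?b"
      using cx_ind cx_span by (simp add: is_basis_def)
    show "cx_star s ` ?b ` {..<r} = ?b ` {..<r}"
    proof -
      have "\<sigma> ` {..<r} = {..<r}"
        using \<sigma>(1,2) by (force simp: image_iff)
      moreover have "cx_star s ` ?b ` {..<r} = ?b ` \<sigma> ` {..<r}"
        unfolding image_image by (rule image_cong) (simp_all add: sb)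
      ultimately show ?thesis by simp
    qed
    have d_embed: "cx_functional d (?b i) = of_real (d (b i))" for i
      using linear_0[OF d(1)] by (simp add: cx_functional_def cx_embed_def complex_eq_iff)
    have d\<sigma>: "d (b (\<sigma> i)) = d (b i)" if "i < r" for i
      using s_b[OF that] d(4) by metis
    show "struct_const r ?b i (star_index r ?b i) 0 = struct_const r ?b (star_index r ?b i) i 0"
      if "i < r" for i
      using that by (simp add: si sc0 \<sigma> d\<sigma>)
    show "struct_const r ?b i j k \<in> \<real>" if "k < r" for i j k
      using that by (simp add: sc)
    show "struct_const r ?b i j 0 \<noteq> 0 \<longleftrightarrow> j = star_index r ?b i" if "i < r" "j < r" for i j
      using that d_pos[OF that(1)] by (simp add: si sc0)
    show "struct_const r ?b i (star_index r ?b i) 0 > 0"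
      and "cx_functional d (?b i) > 0"
      and "cx_functional d (?b i) = struct_const r ?b i (star_index r ?b i) 0" if "i < r" for i
      using that d_pos[OF that] \<sigma>(1)[OF that]
      by (simp_all add: si sc0 d_embed less_complex_def)
    show "cx_functional d (cx_mul m x y) = cx_functional d x * cx_functional d y" for x y
      by (cases x, cases y)
        (simp add: cx_functional_def cx_mul_def d linear_diff linear_add complex_eq_iff)
    show "cx_functional d (cx_star s x) = cnj (cx_functional d x)" for x
      by (cases x) (simp add: cx_functional_def cx_star_def d linear_neg complex_eq_iff)
  qed (simp_all add: r_pos b_0 cf[OF d(1)],
      simp add: cx_functional_def cx_embed_def d linear_0 complex_eq_iff)
  then show ?thesis
    by (simp add: real_standard_rba_delta_basis_def r_def)
qed

lemma bilinear_linear_compose: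
  assumes "bilinear m" and "linear \<tau>"
  shows "bilinear (\<lambda>x y. \<tau> (m x y))"
  using assms(1) linear_compose[of "m x" \<tau> for x] linear_compose[of "\<lambda>x. m x y" \<tau> for y] assms(2)
  by (auto simp: bilinear_def o_def)

text \<open>The converse passage: \<tau> is the real part of the coefficient of \<open>b 0\<close>,
  and its Gram relation comes from the axioms on that coefficient together with standardness. On
  basis vectors the relation is symmetric because \<sigma> is an involution and
  \<open>d (b (\<sigma> i)) = d (b i)\<close>; bilinearity extends this to the trace
  property.\<close>

lemma real_standard_rba_delta_basis_trace:
  fixes m :: "'a::real_vector \<Rightarrow> 'a \<Rightarrow> 'a" and d :: "'a \<Rightarrow> real"
  assumes rba: "real_standard_rba_delta_basis m e s r b d"
    and m: "bilinear m" and s: "linear s"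
    and \<sigma>: "\<And>i. i < r \<Longrightarrow> \<sigma> i < r" "\<And>i. i < r \<Longrightarrow> s (b i) = b (\<sigma> i)"
  obtains \<tau> where "linear \<tau>"
    and "\<And>i. i < r \<Longrightarrow> \<tau> (b i) = (if i = 0 then 1 else 0)"
    and "\<And>i j. \<lbrakk>i < r; j < r\<rbrakk> \<Longrightarrow> \<tau> (m (b i) (b j)) = (if j = \<sigma> i then d (b i) else 0)"
    and "\<And>x y. \<tau> (m x y) = \<tau> (m y x)"
    and "\<And>x. x \<in> span (b ` {..<r})"
proof -
  let ?b = "\<lambda>i. cx_embed (b i)"
  interpret standard_rba_delta_basis cx_scale "cx_mul m" "cx_embed e" "cx_star s" r ?b
    "cx_functional d"
    using rba by (simp add: real_standard_rba_delta_basis_def)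
  have inj: "inj_on ?b {..<r}" and ind: "independent (?b ` {..<r})"
    and sp: "x \<in> span (?b ` {..<r})" for x
    using basis by (simp_all add: is_basis_def)
  define \<tau> where "\<tau> x = Re (representation (?b ` {..<r}) (cx_embed x) (?b 0))" for x
  have embed_add: "cx_embed (x + y) = cx_embed x + cx_embed y" for x y :: 'a
    by (simp add: cx_embed_def)
  have embed_scaleR: "cx_embed (c *\<^sub>R x) = cx_scale (of_real c) (cx_embed x)" for c and x :: 'a
    by (simp add: cx_embed_def cx_scale_def)
  have "linear \<tau>"
    by (rule linearI)
      (simp_all add: \<tau>_def embed_add embed_scaleR representation_add[OF ind sp sp]
        representation_scale[OF ind sp])
  moreover have "\<tau> (b i) = (if i = 0 then 1 else 0)" if "i < r" for i
  proof -
    have "?b i \<in> ?b ` {..<r}" using that by blast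
    moreover have "?b 0 = ?b i \<longleftrightarrow> i = 0"
      using inj that r_pos by (auto simp: inj_on_def)
    ultimately show ?thesis by (simp add: \<tau>_def representation_basis[OF ind])
  qed
  moreover have gram: "\<tau> (m (b i) (b j)) = (if j = \<sigma> i then d (b i) else 0)" if "i < r" "j < r" for i j
  proof -
    have si: "star_index r ?b i = \<sigma> i"
      unfolding star_index_def
    proof (rule the_equality)
      show "\<sigma> i < r \<and> ?b (\<sigma> i) = cx_star s (?b i)"
        using \<sigma> that(1) linear_0[OF s] by (simp add: cx_star_def cx_embed_def)
      then show "j = \<sigma> i" if "j < r \<and> ?b j = cx_star s (?b i)" for j
        using inj that by (simp add: inj_on_def)
    qed
    have "cx_embed (m (b i) (b j)) = cx_mul m (?b i) (?b j)"
      using bilinear_lzero[OF m] bilinear_rzero[OF m] by (simp add: cx_mul_def cx_embed_def)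
    then have "\<tau> (m (b i) (b j)) = Re (struct_const r ?b i j 0)"
      by (simp add: \<tau>_def struct_const_def)
    moreover have "Re (cx_functional d (?b i)) = d (b i)"
      by (simp add: cx_functional_def cx_embed_def)
    ultimately show ?thesis
      using struct_const_0_iff[OF that] standard[OF that(1)] by (auto simp: si)
  qed
  moreover have real_span: "x \<in> Real_Vector_Spaces.span (b ` {..<r})" for x
  proof -
    have "cx_embed x = (\<Sum>w\<in>?b ` {..<r}. cx_scale (representation (?b ` {..<r}) (cx_embed x) w) w)"
      by (rule sum_representation_eq[symmetric]) (use ind sp in auto)
    also have "\<dots> = (\<Sum>i<r. cx_scale (representation (?b ` {..<r}) (cx_embed x) (?b i)) (?b i))"
      using inj by (simp add: sum.reindex)
    finally have "x = (\<Sum>i<r. Re (representation (?b ` {..<r}) (cx_embed x) (?b i)) *\<^sub>R b i)"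
      by (simp add: cx_embed_def cx_scale_def prod_eq_iff fst_sum)
    then show ?thesis
      by (metis (no_types, lifting) real_vector.span_sum real_vector.span_scale
          real_vector.span_base imageI)
  qed
  moreover have "\<tau> (m x y) = \<tau> (m y x)" for x y
  proof -
    have s_s: "s (s x) = x" for x
      using star_star[of "cx_embed x"] linear_0[OF s] by (simp add: cx_star_def cx_embed_def)
    have \<sigma>\<sigma>: "\<sigma> (\<sigma> i) = i" if "i < r" for i
      using inj \<sigma> that s_s[of "b i"] by (auto simp: inj_on_def)
    have bb: "\<tau> (m (b i) (b j)) = \<tau> (m (b j) (b i))" if "i < r" "j < r" for i j
    proof (cases "j = \<sigma> i")
      case True
      have "d (b (\<sigma> i)) = d (b i)"
        using deg_star[of "?b i"] \<sigma>(2)[OF that(1)] linear_0[OF s]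
        by (simp add: cx_star_def cx_embed_def cx_functional_def complex_eq_iff)
      with True that show ?thesis by (simp add: gram \<sigma>\<sigma> \<sigma>(1))
    next
      case False
      then have "i \<noteq> \<sigma> j" using \<sigma>\<sigma> that by auto
      with False that show ?thesis by (simp add: gram)
    qed
    let ?h = "\<lambda>x y. \<tau> (m x y)" and ?h' = "\<lambda>x y. \<tau> (m y x)"
    have "bilinear ?h"
      using m \<open>linear \<tau>\<close> by (rule bilinear_linear_compose)
    moreover from this have "bilinear ?h'"
      by (simp add: bilinear_def)
    ultimately show ?thesis
      using bilinear_eq[of ?h ?h' UNIV "b ` {..<r}" UNIV "b ` {..<r}" x y] real_span bb by auto
  qed
  ultimately show thesis
    using that by blast
qed

section \<open>Plane vectors with prescribed inner products\<close>

text \<open>The inner product of complex numbers is \<open>Re (x * cnj y)\<close>. Multiplying all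
  vectors by the conjugate of one nonzero reference vector fixes the real parts, and the other inner
  products fix all products of imaginary parts. So the imaginary parts agree up to one common sign,
  which decides between rotation and reflection.\<close>

lemma planar_congruence:
  fixes f g :: "'i \<Rightarrow> complex"
  assumes gram: "\<And>i j. \<lbrakk>i \<in> S; j \<in> S\<rbrakk> \<Longrightarrow> f i \<bullet> f j = g i \<bullet> g j"
  obtains u where "cmod u = 1" and "(\<forall>i\<in>S. g i = u * f i) \<or> (\<forall>i\<in>S. g i = u * cnj (f i))"
proof (cases "\<forall>i\<in>S. f i = 0")
  case True
  then have "\<forall>i\<in>S. g i = 0" using gram by fastforce
  with True show thesis using that[of 1] by simp
next
  case False
  then obtain k where k: "k \<in> S" and fk: "f k \<noteq> 0" by blast
  have norm_k: "cmod (g k) = cmod (f k)"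
    using gram[OF k k] by (simp add: dot_square_norm)
  then have gk: "g k \<noteq> 0" using fk by auto
  define x where "x i = f i * cnj (f k)" for i
  define y where "y i = g i * cnj (g k)" for i
  have Re: "Re (x i) = Re (y i)" if "i \<in> S" for i
    using gram[OF that k] by (simp add: x_def y_def inner_complex_def)
  have mult_inner: "(a * cnj c) \<bullet> (b * cnj c) = (cmod c)\<^sup>2 * (a \<bullet> b)" for a b c
    unfolding cmod_power2 by (simp add: inner_complex_def algebra_simps power2_eq_square)
  have "x i \<bullet> x j = y i \<bullet> y j" if "i \<in> S" "j \<in> S" for i j
    unfolding x_def y_def mult_inner using gram[OF that] norm_k by simp
  then have Im: "Im (x i) * Im (x j) = Im (y i) * Im (y j)" if "i \<in> S" "j \<in> S" for i j
    using that Re by (simp add: inner_complex_def)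
  have "(\<forall>i\<in>S. Im (y i) = Im (x i)) \<or> (\<forall>i\<in>S. Im (y i) = - Im (x i))"
  proof (rule disjCI)
    assume "\<not> (\<forall>i\<in>S. Im (y i) = - Im (x i))"
    \<comment> \<open>An index \<open>l\<close> where the opposite sign fails has equal, nonzero
      imaginary parts on both sides; cancelling them from the products with \<open>l\<close>
      transfers the sign to every index.\<close>
    then obtain l where l: "l \<in> S" "Im (y l) \<noteq> - Im (x l)" by blast
    have "(Im (x l))\<^sup>2 = (Im (y l))\<^sup>2" using Im[OF l(1) l(1)] by (simp add: power2_eq_square)
    with l(2) have "Im (x l) = Im (y l)" "Im (x l) \<noteq> 0" by (auto simp: power2_eq_iff)
    then show "\<forall>i\<in>S. Im (y i) = Im (x i)"
      using Im[OF _ l(1)] by (metis mult_right_cancel)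
  qed
  then consider "\<forall>i\<in>S. y i = x i" | "\<forall>i\<in>S. y i = cnj (x i)"
    using Re by (auto simp: complex_eq_iff)
  then show thesis
  proof cases
    case 1
    then have "\<forall>i\<in>S. g i = cnj (f k) / cnj (g k) * f i"
      using gk by (simp add: x_def y_def field_simps)
    moreover have "cmod (cnj (f k) / cnj (g k)) = 1"
      using norm_k fk by (simp add: norm_divide)
    ultimately show thesis using that by blast
  next
    case 2
    then have "\<forall>i\<in>S. g i = f k / cnj (g k) * cnj (f i)"
      using gk by (simp add: x_def y_def field_simps)
    moreover have "cmod (f k / cnj (g k)) = 1"
      using norm_k fk by (simp add: norm_divide)
    ultimately show thesis using that by blast
  qed
qed

text \<open>Here \<open>f\<close>, \<open>g\<close> form an orthonormal basis of the orthogonal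
  complement of \<open>a\<close> and \<open>d\<close>, so the left side is the inner product of the
  projections of \<open>x\<close> and \<open>y\<close> to it. The fraction is the contribution of
  the span of \<open>a\<close> and \<open>d\<close>, expressed by the inverse of their Gram
  matrix.\<close>

lemma orthogonal_complement_of_pair:
  fixes a d :: "'a::euclidean_space"
  assumes dim: "DIM('a) = 4" and gram: "(a \<bullet> d)\<^sup>2 < (a \<bullet> a) * (d \<bullet> d)"
  obtains f g :: 'a where
    "\<And>x y. (f \<bullet> x) * (f \<bullet> y) + (g \<bullet> x) * (g \<bullet> y) = x \<bullet> y -
       ((d \<bullet> d) * (a \<bullet> x) * (a \<bullet> y) - (a \<bullet> d) * ((a \<bullet> x) * (d \<bullet> y) + (d \<bullet> x) * (a \<bullet> y))
         + (a \<bullet> a) * (d \<bullet> x) * (d \<bullet> y)) / ((a \<bullet> a) * (d \<bullet> d) - (a \<bullet> d)\<^sup>2)"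
proof -
  define G where "G = (a \<bullet> a) * (d \<bullet> d) - (a \<bullet> d)\<^sup>2"
  have G: "G \<noteq> 0" using gram by (simp add: G_def)
  define S where "S = {y \<in> UNIV. \<forall>x \<in> span {a, d}. orthogonal x y}"
  have S_iff: "y \<in> S \<longleftrightarrow> a \<bullet> y = 0 \<and> d \<bullet> y = 0" for y
  proof
    assume "y \<in> S"
    then show "a \<bullet> y = 0 \<and> d \<bullet> y = 0"
      by (auto simp: S_def orthogonal_def intro: span_base)
  next
    assume "a \<bullet> y = 0 \<and> d \<bullet> y = 0"
    then have "\<And>x. x \<in> {a, d} \<Longrightarrow> orthogonal y x"
      by (auto simp: orthogonal_def inner_commute)
    then show "y \<in> S"
      using orthogonal_to_span[of _ "{a, d}" y] by (auto simp: S_def orthogonal_commute)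
  qed
  \<comment> \<open>Linear dependence would give equality in the Cauchy-Schwarz inequality.\<close>
  have "d \<noteq> 0" "a \<notin> span {d}"
    using gram by (auto simp: span_singleton power2_eq_square)
  then have "independent {a, d}" "a \<noteq> d"
    by (auto simp: independent_insert intro: span_base)
  then have "dim (span {a, d}) = 2"
    by (simp add: dim_eq_card_independent)
  then have "dim S = 2"
    using dim_subspace_orthogonal_to_vectors[of "span {a, d}" UNIV] dim by (simp add: S_def)
  moreover have "subspace S"
    by (auto simp: subspace_def S_iff inner_add_right)
  ultimately obtain B where B: "B \<subseteq> S" "pairwise orthogonal B" "\<And>x. x \<in> B \<Longrightarrow> norm x = 1"
      "card B = 2" "span B = S"
    by (metis orthonormal_basis_subspace)
  then obtain f g where fg: "B = {f, g}" "f \<noteq> g" by (auto simp: card_2_iff)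
  have "(f \<bullet> x) * (f \<bullet> y) + (g \<bullet> x) * (g \<bullet> y) = x \<bullet> y -
       ((d \<bullet> d) * (a \<bullet> x) * (a \<bullet> y) - (a \<bullet> d) * ((a \<bullet> x) * (d \<bullet> y) + (d \<bullet> x) * (a \<bullet> y))
         + (a \<bullet> a) * (d \<bullet> x) * (d \<bullet> y)) / G" for x y
  proof -
    \<comment> \<open>By Cramer's rule \<alpha> and \<beta> are the coordinates of the projection of
      \<open>x\<close> to the span of \<open>a\<close> and \<open>d\<close>; hence \<open>p\<close>
      is its projection to the complement.\<close>
    define \<alpha> where "\<alpha> = ((d \<bullet> d) * (a \<bullet> x) - (a \<bullet> d) * (d \<bullet> x)) / G"
    define \<beta> where "\<beta> = ((a \<bullet> a) * (d \<bullet> x) - (a \<bullet> d) * (a \<bullet> x)) / G"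
    define p where "p = x - \<alpha> *\<^sub>R a - \<beta> *\<^sub>R d"
    have "a \<bullet> p = (G * (a \<bullet> x) - ((d \<bullet> d) * (a \<bullet> x) - (a \<bullet> d) * (d \<bullet> x)) * (a \<bullet> a)
        - ((a \<bullet> a) * (d \<bullet> x) - (a \<bullet> d) * (a \<bullet> x)) * (a \<bullet> d)) / G"
      and "d \<bullet> p = (G * (d \<bullet> x) - ((d \<bullet> d) * (a \<bullet> x) - (a \<bullet> d) * (d \<bullet> x)) * (a \<bullet> d)
        - ((a \<bullet> a) * (d \<bullet> x) - (a \<bullet> d) * (a \<bullet> x)) * (d \<bullet> d)) / G"
      using G by (simp_all add: p_def \<alpha>_def \<beta>_def inner_diff_right inner_commute[of d a] diff_divide_distrib add_divide_distrib left_diff_distrib)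
    then have "a \<bullet> p = 0" "d \<bullet> p = 0"
      by (simp_all add: G_def algebra_simps power2_eq_square)
    then have pS: "p \<in> span B" using B(5) by (simp add: S_iff)
    have "(\<Sum>v\<in>B. (p \<bullet> v) *\<^sub>R v) = p"
      by (rule orthonormal_basis_expand[OF B(2,3) pS]) (simp_all add: fg)
    then have p: "(p \<bullet> f) *\<^sub>R f + (p \<bullet> g) *\<^sub>R g = p"
      using fg by simp
    have "f \<in> S" "g \<in> S" using B(1) fg by auto
    then have "p \<bullet> f = f \<bullet> x" "p \<bullet> g = g \<bullet> x"
      by (simp_all add: p_def S_iff inner_diff_left inner_diff_right inner_commute)
    with p have "(f \<bullet> x) * (f \<bullet> y) + (g \<bullet> x) * (g \<bullet> y) = p \<bullet> y"
      by (metis inner_add_left inner_scaleR_left)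
    also have "p \<bullet> y = x \<bullet> y - (\<alpha> * (a \<bullet> y) + \<beta> * (d \<bullet> y))"
      by (simp add: p_def inner_diff_left)
    also have "\<alpha> * (a \<bullet> y) + \<beta> * (d \<bullet> y) =
       ((d \<bullet> d) * (a \<bullet> x) * (a \<bullet> y) - (a \<bullet> d) * ((a \<bullet> x) * (d \<bullet> y) + (d \<bullet> x) * (a \<bullet> y))
         + (a \<bullet> a) * (d \<bullet> x) * (d \<bullet> y)) / G"
      using G by (simp add: \<alpha>_def \<beta>_def field_simps)
    finally show ?thesis .
  qed
  then show thesis
    using that unfolding G_def by blast
qed

section \<open>Two-by-two matrices and triples\<close>

lemma mat2_nth [simp]:
  "mat2 a b c d $ 1 $ 1 = a" "mat2 a b c d $ 1 $ 2 = b"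
  "mat2 a b c d $ 2 $ 1 = c" "mat2 a b c d $ 2 $ 2 = d"
  by (simp_all add: mat2_def)

lemma mat2_eq_iff: "Z = mat2 a b c d \<longleftrightarrow> Z $ 1 $ 1 = a \<and> Z $ 1 $ 2 = b \<and> Z $ 2 $ 1 = c \<and> Z $ 2 $ 2 = d"
  by (auto simp: vec_eq_iff forall_2)

lemma mat2_mult:
  "mat2 a b c d ** mat2 a' b' c' d' = mat2 (a*a' + b*c') (a*b' + b*d') (c*a' + d*c') (c*b' + d*d')"
  by (simp add: mat2_eq_iff matrix_matrix_mult_def sum_2)

lemma transpose_mat2: "transpose (mat2 a b c d) = mat2 a c b d"
  by (simp add: mat2_eq_iff transpose_def)

lemma trace_mat2: "trace (mat2 a b c d) = a + d"
  by (simp add: trace_def sum_2)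

lemma mat_1_mat2: "mat 1 = mat2 1 0 0 1"
  by (simp add: mat2_eq_iff mat_def)

text \<open>Orthogonal conjugation acts on \<open>w\<close> by a plane isometry and on \<open>z\<close> by the determinant.\<close>

definition mat_parts :: "real \<Rightarrow> complex \<Rightarrow> real \<Rightarrow> real^2^2" where
  "mat_parts t w z = mat2 (t/2 + Re w) (Im w + z) (Im w - z) (t/2 - Re w)"

lemma mat_parts_cases:
  obtains t w z where "Z = mat_parts t w z"
proof
  show "Z = mat_parts (Z$1$1 + Z$2$2) (Complex ((Z$1$1 - Z$2$2)/2) ((Z$1$2 + Z$2$1)/2)) ((Z$1$2 - Z$2$1)/2)"
    by (simp add: mat_parts_def mat2_eq_iff field_simps)
qed

lemma transpose_mat_parts: "transpose (mat_parts t w z) = mat_parts t w (-z)"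
  by (simp add: mat_parts_def transpose_mat2)

lemma mat_1_mat_parts: "mat 1 = mat_parts 2 0 0"
  by (simp add: mat_parts_def mat_1_mat2)

lemma mat_parts_eq_iff: "mat_parts t w z = mat_parts t' w' z' \<longleftrightarrow> t = t' \<and> w = w' \<and> z = z'"
  by (auto simp: mat_parts_def mat2_eq_iff complex_eq_iff)

lemma trace_mat_parts: "trace (mat_parts t w z) = t"
  by (simp add: mat_parts_def trace_mat2)

lemma trace_mult_mat_parts:
  "trace (mat_parts t w z ** mat_parts t' w' z') = t * t' / 2 + 2 * (w \<bullet> w') - 2 * z * z'"
  by (simp add: mat_parts_def mat2_mult trace_mat2 inner_complex_def field_simps)

section \<open>Conjugation by orthogonal matrices\<close>

lemma matrix_inv_orthogonal:
  fixes Q :: "real^'n^'n"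
  assumes "orthogonal_matrix Q"
  shows "matrix_inv Q = transpose Q"
proof -
  have Q: "transpose Q ** Q = mat 1" "Q ** transpose Q = mat 1"
    using assms by (auto simp: orthogonal_matrix_def)
  then have "Q ** matrix_inv Q = mat 1 \<and> matrix_inv Q ** Q = mat 1"
    unfolding matrix_inv_def by (metis (mono_tags, lifting) someI)
  then show ?thesis
    using Q by (metis matrix_mul_assoc matrix_mul_lid matrix_mul_rid)
qed

lemma norm_1_squared:
  assumes "cmod v = 1"
  shows "(Re v)\<^sup>2 + (Im v)\<^sup>2 = 1"
  using assms by (metis cmod_power2 one_power2)

text \<open>Conjugation turns the traceless symmetric part by twice the angle of \<open>Q\<close>,
  hence the square of \<open>v\<close>; the skew part commutes with rotations.\<close>

lemma rotation_conj_mat_parts: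
  assumes v: "cmod v = 1"
  defines "Q \<equiv> mat2 (Re v) (- Im v) (Im v) (Re v)"
  shows "orthogonal_matrix Q" and "Q ** mat_parts t w z ** matrix_inv Q = mat_parts t (v\<^sup>2 * w) z"
proof -
  have *: "Re v * Re v = 1 - Im v * Im v"
    using norm_1_squared[OF v] by (simp add: power2_eq_square)
  show orth: "orthogonal_matrix Q"
    by (simp add: Q_def orthogonal_matrix_def transpose_mat2 mat2_mult mat_1_mat2 *)
  show "Q ** mat_parts t w z ** matrix_inv Q = mat_parts t (v\<^sup>2 * w) z"
    unfolding matrix_inv_orthogonal[OF orth]
    by (simp add: Q_def mat_parts_def transpose_mat2 mat2_mult power2_eq_square algebra_simps
        diff_divide_distrib *)
qed

text \<open>This \<open>Q\<close> is the rotation for \<open>v\<close> times the diagonal matrix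
  with entries 1 and -1; conjugation by the latter negates the off-diagonal entries, which
  conjugates \<open>w\<close> and negates \<open>z\<close>.\<close>

lemma reflection_conj_mat_parts:
  assumes v: "cmod v = 1"
  defines "Q \<equiv> mat2 (Re v) (Im v) (Im v) (- Re v)"
  shows "orthogonal_matrix Q"
    and "Q ** mat_parts t w z ** matrix_inv Q = mat_parts t (v\<^sup>2 * cnj w) (- z)"
proof -
  have *: "Re v * Re v = 1 - Im v * Im v"
    using norm_1_squared[OF v] by (simp add: power2_eq_square)
  show orth: "orthogonal_matrix Q"
    by (simp add: Q_def orthogonal_matrix_def transpose_mat2 mat2_mult mat_1_mat2 *)
  show "Q ** mat_parts t w z ** matrix_inv Q = mat_parts t (v\<^sup>2 * cnj w) (- z)"
    unfolding matrix_inv_orthogonal[OF orth]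
    by (simp add: Q_def mat_parts_def transpose_mat2 mat2_mult power2_eq_square algebra_simps
        diff_divide_distrib *)
qed

section \<open>Traces on the algebra of triples\<close>

lemma bilinear_triple_mul: "bilinear triple_mul"
  by (auto simp: bilinear_def triple_mul_def algebra_simps matrix_add_ldistrib scalar_matrix_assoc
      matrix_scalar_ac matrix_matrix_mult_def sum.distrib vec_eq_iff sum_distrib_left
      intro!: linearI)

lemma linear_triple_star: "linear triple_star"
  by (auto simp: triple_star_def transpose_def vec_eq_iff intro!: linearI)

lemma linear_triple_deg: "linear triple_deg"
  by (auto simp: triple_deg_def intro!: linearI)

lemma trace_scaleR: "trace (c *\<^sub>R A) = c * trace (A :: real^'n^'n)"
  by (simp add: trace_def sum_distrib_left)

text \<open>A trace vanishes on commutators. With matrix units, \<open>E12 = [E11, E12]\<close>,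
  \<open>E21 = [E21, E11]\<close> and \<open>E11 - E22 = [E12, E21]\<close>, so on the matrix
  summand only a multiple of the usual trace is left.\<close>

lemma trace_linear_functional_triple:
  fixes \<tau> :: "triple \<Rightarrow> real"
  assumes \<tau>: "linear \<tau>" and comm: "\<And>x y. \<tau> (triple_mul x y) = \<tau> (triple_mul y x)"
  obtains a b c where "\<And>x y Z. \<tau> (x, y, Z) = a * x + b * y + c * trace Z"
proof -
  let ?E = "\<lambda>p q r s. (0, 0, mat2 p q r s) :: triple"
  have mul: "triple_mul (?E p q r s) (?E j k l m)
      = ?E (p * j + q * l) (p * k + q * m) (r * j + s * l) (r * k + s * m)" for p q r s j k l m
    by (simp add: triple_mul_def mat2_mult)
  have zero: "?E 0 0 0 0 = 0"
    by (simp add: zero_prod_def vec_eq_iff forall_2)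
  have off: "\<tau> (?E 0 1 0 0) = 0" "\<tau> (?E 0 0 1 0) = 0"
    using comm[of "?E 1 0 0 0" "?E 0 1 0 0"] comm[of "?E 0 0 1 0" "?E 1 0 0 0"] linear_0[OF \<tau>]
    by (simp_all add: mul zero)
  have diag: "\<tau> (?E 1 0 0 0) = \<tau> (?E 0 0 0 1)"
    using comm[of "?E 0 1 0 0" "?E 0 0 1 0"] by (simp add: mul)
  have "\<tau> (x, y, Z) = \<tau> (1, 0, 0) * x + \<tau> (0, 1, 0) * y + \<tau> (?E 1 0 0 0) * trace Z" for x y Z
  proof -
    have "(x, y, Z) = x *\<^sub>R (1, 0, 0) + y *\<^sub>R (0, 1, 0) + Z$1$1 *\<^sub>R ?E 1 0 0 0
        + Z$1$2 *\<^sub>R ?E 0 1 0 0 + Z$2$1 *\<^sub>R ?E 0 0 1 0 + Z$2$2 *\<^sub>R ?E 0 0 0 1"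
      by (simp add: vec_eq_iff forall_2)
    then show ?thesis
      using off diag
      by (simp only: linear_add[OF \<tau>] linear_scale[OF \<tau>]) (simp add: trace_def sum_2 algebra_simps)
  qed
  then show thesis by (rule that)
qed

section \<open>Uniqueness\<close>

text \<open>Used in two roles: as the involution of indices induced by \<open>triple_star\<close>,
  and as the permutation that corrects the sign of the skew part of \<open>B 4\<close>.\<close>

abbreviation swap45 :: "nat \<Rightarrow> nat" where
  "swap45 \<equiv> Transposition.transpose 4 5"

lemma less_6_cases:
  assumes "i < (6::nat)"
  obtains "i = 0" | "i = 1" | "i = 2" | "i = 3" | "i = 4" | "i = 5"
  using assms by linarith

lemma sum_less_6: "(\<Sum>i<6. f i) = f 0 + f 1 + f 2 + f 3 + f 4 + f (5::nat)"
  for f :: "nat \<Rightarrow> 'a::comm_monoid_add"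
  by (simp add: lessThan_nat_numeral numeral_eq_Suc ac_simps)

lemma index_perms_id: "id \<in> index_perms"
  and index_perms_swap45: "swap45 \<in> index_perms"
proof -
  have "id \<in> generate (sym_group 5) H" for H
    using generate.one[of "sym_group 5"] by (simp add: sym_group_one)
  moreover have "swap45 \<in> generate (sym_group 5) {cycle_of_list [4, 5]}"
    using generate.incl[of "cycle_of_list [4, 5]" _ "sym_group 5"] by simp
  moreover have "x \<circ> y \<in> index_perms"
    if "x \<in> generate (sym_group 5) {cycle_of_list [1, 2], cycle_of_list [1, 2, 3]}"
      "y \<in> generate (sym_group 5) {cycle_of_list [4, 5]}" for x y
    unfolding index_perms_def set_mult_def sym_group_mult using that by blast
  ultimately show "id \<in> index_perms" "swap45 \<in> index_perms"
    by (metis id_comp)+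
qed

text \<open>By Lagrange's identity, the assumption on the ratios \<open>\<phi> i / \<delta> i\<close> is the strict case of
  the Cauchy-Schwarz inequality for \<open>(\<Sum>i. \<phi> i)\<^sup>2\<close>, where \<open>i = 0\<close> is left out.\<close>

lemma degree_multiplicity_gap:
  fixes \<delta> \<phi> :: "nat \<Rightarrow> real"
  assumes pos: "\<forall>i\<in>{1..4}. \<delta> i > 0"
    and sum0: "1 + \<phi> 1 + \<phi> 2 + \<phi> 3 + 2 * \<phi> 4 = 0"
    and ends: "\<delta> 0 = 1" "\<delta> 5 = \<delta> 4" "\<phi> 0 = 1" "\<phi> 5 = \<phi> 4"
    and ratio: "\<exists>i\<in>{1,2,3}. \<phi> 4 / \<delta> 4 \<noteq> \<phi> i / \<delta> i"
  shows "1 < ((\<Sum>i<6. \<delta> i) - 1) * ((\<Sum>i<6. (\<phi> i)\<^sup>2 / \<delta> i) - 1)"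
proof -
  define p where "p i = \<phi> i / \<delta> i" for i
  have \<delta>: "\<delta> 1 > 0" "\<delta> 2 > 0" "\<delta> 3 > 0" "\<delta> 4 > 0" using pos by auto
  have \<phi>: "\<phi> 1 = \<delta> 1 * p 1" "\<phi> 2 = \<delta> 2 * p 2" "\<phi> 3 = \<delta> 3 * p 3" "\<phi> 4 = \<delta> 4 * p 4"
    using \<delta> by (simp_all add: p_def)
  have n: "(\<Sum>i<6. \<delta> i) - 1 = \<delta> 1 + \<delta> 2 + \<delta> 3 + 2 * \<delta> 4"
    by (simp add: sum_less_6 ends)
  have m: "(\<Sum>i<6. (\<phi> i)\<^sup>2 / \<delta> i) - 1 = \<delta> 1 * (p 1)\<^sup>2 + \<delta> 2 * (p 2)\<^sup>2 + \<delta> 3 * (p 3)\<^sup>2 + 2 * \<delta> 4 * (p 4)\<^sup>2"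
    using \<delta> by (simp add: sum_less_6 ends \<phi> power2_eq_square del: One_nat_def)
  have s: "\<delta> 1 * p 1 + \<delta> 2 * p 2 + \<delta> 3 * p 3 + 2 * \<delta> 4 * p 4 = -1"
    using sum0 by (simp add: \<phi> del: One_nat_def)
  \<comment> \<open>The weights are \<open>\<delta> 1\<close>, \<open>\<delta> 2\<close>,
    \<open>\<delta> 3\<close> and, with 4 and 5 merged, \<open>2 * \<delta> 4\<close>; so only
    differences among \<open>p 1\<close> to \<open>p 4\<close> occur.\<close>
  have "((\<Sum>i<6. \<delta> i) - 1) * ((\<Sum>i<6. (\<phi> i)\<^sup>2 / \<delta> i) - 1)
      - (\<delta> 1 * p 1 + \<delta> 2 * p 2 + \<delta> 3 * p 3 + 2 * \<delta> 4 * p 4)\<^sup>2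
    = \<delta> 1 * \<delta> 2 * (p 1 - p 2)\<^sup>2 + \<delta> 1 * \<delta> 3 * (p 1 - p 3)\<^sup>2 + \<delta> 2 * \<delta> 3 * (p 2 - p 3)\<^sup>2
      + 2 * \<delta> 1 * \<delta> 4 * (p 4 - p 1)\<^sup>2 + 2 * \<delta> 2 * \<delta> 4 * (p 4 - p 2)\<^sup>2 + 2 * \<delta> 3 * \<delta> 4 * (p 4 - p 3)\<^sup>2"
    unfolding n m by algebra
  moreover have "0 \<le> \<delta> 1 * \<delta> 2 * (p 1 - p 2)\<^sup>2" "0 \<le> \<delta> 1 * \<delta> 3 * (p 1 - p 3)\<^sup>2"
      "0 \<le> \<delta> 2 * \<delta> 3 * (p 2 - p 3)\<^sup>2" "0 \<le> 2 * \<delta> 1 * \<delta> 4 * (p 4 - p 1)\<^sup>2"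
      "0 \<le> 2 * \<delta> 2 * \<delta> 4 * (p 4 - p 2)\<^sup>2" "0 \<le> 2 * \<delta> 3 * \<delta> 4 * (p 4 - p 3)\<^sup>2"
    using \<delta> by simp_all
  moreover have "0 < 2 * \<delta> 1 * \<delta> 4 * (p 4 - p 1)\<^sup>2 \<or> 0 < 2 * \<delta> 2 * \<delta> 4 * (p 4 - p 2)\<^sup>2 \<or> 0 < 2 * \<delta> 3 * \<delta> 4 * (p 4 - p 3)\<^sup>2"
  proof -
    have "p 4 - p 1 \<noteq> 0 \<or> p 4 - p 2 \<noteq> 0 \<or> p 4 - p 3 \<noteq> 0"
      using ratio by (auto simp: p_def)
    then show ?thesis
      using \<delta> by (elim disjE) (simp_all del: One_nat_def)
  qed
  moreover have "(\<delta> 1 * p 1 + \<delta> 2 * p 2 + \<delta> 3 * p 3 + 2 * \<delta> 4 * p 4)\<^sup>2 = 1"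
    unfolding s by simp
  ultimately show ?thesis by linarith
qed

text \<open>This determines the three weights of the trace. Representing the two scalar coordinates
  through \<tau> gives \<open>1/n\<close> and \<open>1/m\<close>, and the value 1 at the identity
  gives the third. All \<open>trace (B i ** B j)\<close> are thereby prescribed as soon as the third
  weight is nonzero.\<close>

lemma rba_family_gram:
  fixes \<delta> \<phi> :: "nat \<Rightarrow> real"
  assumes fam: "rba_family \<delta> \<phi> B"
    and \<delta>: "\<And>i. i < 6 \<Longrightarrow> \<delta> i > 0" and ends: "\<delta> 0 = 1" "\<delta> 5 = \<delta> 4" "\<phi> 0 = 1" "\<phi> 5 = \<phi> 4"
    and ij: "i < 6" "j < 6"
  defines "n \<equiv> \<Sum>i<6. \<delta> i" and "m \<equiv> \<Sum>i<6. (\<phi> i)\<^sup>2 / \<delta> i"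
  shows "\<delta> i * \<delta> j / n + \<phi> i * \<phi> j / m + (1 - 1/n - 1/m) / 2 * trace (B i ** B j)
    = (if j = swap45 i then \<delta> i else 0)"
proof -
  define b where "b = (\<lambda>i. (\<delta> i, \<phi> i, B i))"
  have rba: "real_standard_rba_delta_basis triple_mul triple_one triple_star 6 b triple_deg"
    and B0: "B 0 = mat 1" and B123: "\<forall>i\<in>{1,2,3}. \<exists>r s u. B i = mat2 r s s u"
    and B5: "B 5 = transpose (B 4)"
    using fam by (simp_all add: rba_family_def b_def)
  have B_star: "transpose (B i) = B (swap45 i)" if "i < 6" for i
    using that
  proof (cases rule: less_6_cases)
    case 1
    then show ?thesis by (simp add: B0 Transposition.transpose_def)
  qed (use B123 B5 in \<open>auto simp: Transposition.transpose_def transpose_mat2\<close>)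
  have ends_swap: "\<delta> (swap45 i) = \<delta> i" "\<phi> (swap45 i) = \<phi> i" for i
    using ends by (simp_all add: Transposition.transpose_def)
  have star: "triple_star (b i) = b (swap45 i)" if "i < 6" for i
    using B_star[OF that] ends_swap by (simp add: triple_star_def b_def)
  have swap_less: "swap45 i < 6" if "i < 6" for i
    using that by (simp add: Transposition.transpose_def)
  obtain \<tau> where \<tau>: "linear \<tau>" "\<And>i. i < 6 \<Longrightarrow> \<tau> (b i) = (if i = 0 then 1 else 0)"
    "\<And>i j. \<lbrakk>i < 6; j < 6\<rbrakk> \<Longrightarrow> \<tau> (triple_mul (b i) (b j)) = (if j = swap45 i then triple_deg (b i) else 0)"
    "\<And>x y. \<tau> (triple_mul x y) = \<tau> (triple_mul y x)"
    and sp: "\<And>x. x \<in> span (b ` {..<6})"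
    using real_standard_rba_delta_basis_trace[OF rba bilinear_triple_mul linear_triple_star swap_less star]
    by blast
  obtain a1 a2 c where form: "\<And>x y Z. \<tau> (x, y, Z) = a1 * x + a2 * y + c * trace Z"
    using trace_linear_functional_triple[OF \<tau>(1,4)] by blast
  have deg: "triple_deg (b i) = \<delta> i" for i by (simp add: triple_deg_def b_def)
  have bil: "bilinear (\<lambda>x y. \<tau> (triple_mul x y))"
    using bilinear_triple_mul \<tau>(1) by (rule bilinear_linear_compose)
  \<comment> \<open>Since \<tau> pairs \<open>b i\<close> only with \<open>b (swap45 i)\<close>,
    with value \<open>\<delta> i\<close>, every linear functional has an explicit representing
    vector.\<close>
  have dual: "l x = \<tau> (triple_mul x (\<Sum>j<6. (l (b (swap45 j)) / \<delta> j) *\<^sub>R b j))"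
    if l: "linear l" for l :: "triple \<Rightarrow> real" and x
  proof -
    let ?e = "\<Sum>j<6. (l (b (swap45 j)) / \<delta> j) *\<^sub>R b j"
    have lin: "linear (\<lambda>x. \<tau> (triple_mul x ?e))"
      using bil unfolding bilinear_def by blast
    have "l (b i) = \<tau> (triple_mul (b i) ?e)" if "i < 6" for i
    proof -
      have lin_i: "linear (\<lambda>y. \<tau> (triple_mul (b i) y))"
        using bil unfolding bilinear_def by blast
      have "\<tau> (triple_mul (b i) ?e) = (\<Sum>j<6. l (b (swap45 j)) / \<delta> j * \<tau> (triple_mul (b i) (b j)))"
        by (simp add: linear_sum[OF lin_i] linear_scale[OF lin_i])
      also have "\<dots> = (\<Sum>j<6. if j = swap45 i then l (b i) else 0)"
        using that \<delta> by (intro sum.cong) (auto simp: \<tau>(3) deg ends_swap less_imp_neq[symmetric])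
      also have "\<dots> = l (b i)"
        using swap_less[OF that] by simp
      finally show ?thesis by simp
    qed
    then show ?thesis
      using linear_eq_on_span[OF l lin, of "b ` {..<6}"] sp by blast
  qed
  have "linear (\<lambda>x :: triple. fst x)" "linear (\<lambda>x :: triple. fst (snd x))"
    by (auto intro!: linearI)
  note dual = this[THEN dual]
  \<comment> \<open>Multiplication by \<open>(1, 0, 0)\<close> keeps only the first coordinate
    \<open>n\<close> of the representing vector, on which \<tau> acts by \<open>a1\<close>. The
    second coordinate yields \<open>a2\<close> in the same way.\<close>
  have n: "a1 * n = 1"
  proof -
    have "1 = \<tau> (triple_mul (1, 0, 0) (\<Sum>j<6. b j))"
      using dual(1)[of "(1, 0, 0)"] \<delta> by (simp add: b_def ends_swap less_imp_neq[symmetric])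
    also have "triple_mul (1, 0, 0) (\<Sum>j<6. b j) = (n, 0, 0)"
      by (simp add: triple_mul_def split_beta fst_sum b_def n_def)
    finally show ?thesis by (simp add: form trace_def)
  qed
  have m: "a2 * m = 1"
  proof -
    have "1 = \<tau> (triple_mul (0, 1, 0) (\<Sum>j<6. (\<phi> j / \<delta> j) *\<^sub>R b j))"
      using dual(2)[of "(0, 1, 0)"] by (simp add: b_def ends_swap)
    also have "triple_mul (0, 1, 0) (\<Sum>j<6. (\<phi> j / \<delta> j) *\<^sub>R b j) = (0, m, 0)"
      by (simp add: triple_mul_def split_beta fst_sum snd_sum b_def m_def power2_eq_square)
    finally show ?thesis by (simp add: form trace_def)
  qed
  have "a1 + a2 + 2 * c = 1"
    using \<tau>(2)[of 0] by (simp add: b_def ends B0 form trace_I)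
  moreover have "n \<noteq> 0" "m \<noteq> 0" using n m by auto
  then have "a1 = 1 / n" "a2 = 1 / m" using n m by (simp_all add: field_simps)
  ultimately have c: "c = (1 - 1/n - 1/m) / 2" by simp
  have "\<tau> (triple_mul (b i) (b j)) = \<delta> i * \<delta> j / n + \<phi> i * \<phi> j / m + c * trace (B i ** B j)"
    using \<open>a1 = 1 / n\<close> \<open>a2 = 1 / m\<close> by (simp add: b_def triple_mul_def form)
  then show ?thesis
    using \<tau>(3)[OF ij] unfolding c deg by (rule trans[OF sym])
qed

text \<open>Pairing with the identity recovers \<open>t\<close>. The remaining traces give the Gram
  matrix of the \<open>w i\<close>, hence these vectors up to a plane isometry, and
  \<open>z 4\<close> up to sign; the isometry lifts to an orthogonal conjugation.\<close>

lemma orthogonally_conjugate_if_same_traces: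
  fixes B B' :: "nat \<Rightarrow> real^2^2"
  assumes B: "B 0 = mat 1" "\<forall>i\<in>{1,2,3}. \<exists>r s u. B i = mat2 r s s u" "B 5 = transpose (B 4)"
    and B': "B' 0 = mat 1" "\<forall>i\<in>{1,2,3}. \<exists>r s u. B' i = mat2 r s s u" "B' 5 = transpose (B' 4)"
    and tr: "\<And>i j. \<lbrakk>i < 6; j < 6\<rbrakk> \<Longrightarrow> trace (B i ** B j) = trace (B' i ** B' j)"
  shows "\<exists>Q. \<exists>\<pi>\<in>{id, swap45}. orthogonal_matrix Q \<and> (\<forall>i\<le>5. B' i = Q ** B (\<pi> i) ** matrix_inv Q)"
proof -
  have parts: "\<exists>t w z. (\<forall>i. B i = mat_parts (t i) (w i) (z i)) \<and> w 0 = 0 \<and> t 5 = t 4 \<and> w 5 = w 4 \<and> z 5 = - z 4 \<and>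
       (\<forall>i\<in>{0,1,2,3}. z i = 0)"
    if B: "B 0 = mat 1" "\<forall>i\<in>{1,2,3}. \<exists>r s u. B i = mat2 r s s u" "B 5 = transpose (B 4)"
    for B :: "nat \<Rightarrow> real^2^2"
  proof -
    have "\<forall>i. \<exists>t w z. B i = mat_parts t w z" by (metis mat_parts_cases)
    then obtain t w z where *: "\<forall>i. B i = mat_parts (t i) (w i) (z i)" by metis
    moreover have "w 0 = 0" "z 0 = 0"
      using B(1) * by (simp_all add: mat_1_mat_parts mat_parts_eq_iff)
    moreover have "t 5 = t 4" "w 5 = w 4" "z 5 = - z 4"
      using B(3) * by (simp_all add: transpose_mat_parts mat_parts_eq_iff)
    moreover have "z i = 0" if "i \<in> {1,2,3}" for i
    proof -
      obtain r s u where "mat_parts (t i) (w i) (z i) = mat2 r s s u" using B(2) * \<open>i \<in> {1,2,3}\<close> by metis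
      then show ?thesis by (auto simp: mat_parts_def mat2_eq_iff)
    qed
    ultimately show ?thesis by blast
  qed
  obtain t w z where P: "\<And>i. B i = mat_parts (t i) (w i) (z i)" and P0: "w 0 = 0"
    and P5: "t 5 = t 4" "w 5 = w 4" "z 5 = - z 4" and Pz: "\<And>i. i \<in> {0,1,2,3} \<Longrightarrow> z i = 0"
    using parts[OF B] by blast
  obtain t' w' z' where P': "\<And>i. B' i = mat_parts (t' i) (w' i) (z' i)" and P0': "w' 0 = 0"
    and P5': "t' 5 = t' 4" "w' 5 = w' 4" "z' 5 = - z' 4" and Pz': "\<And>i. i \<in> {0,1,2,3} \<Longrightarrow> z' i = 0"
    using parts[OF B'] by blast
  have t: "t' i = t i" if "i < 6" for i
    using tr[OF that, of 0] P[of i] P'[of i] by (simp add: B B' trace_mat_parts)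
  have tr': "w i \<bullet> w j - z i * z j = w' i \<bullet> w' j - z' i * z' j" if "i < 6" "j < 6" for i j
    using tr[OF that] t that by (simp add: P P' trace_mult_mat_parts)
  \<comment> \<open>The skew term enters the pairs (4,4) and (4,5) with opposite signs: the sum
    isolates \<open>w 4\<close>, the difference \<open>z 4\<close>.\<close>
  have w45: "w 4 \<bullet> w 4 = w' 4 \<bullet> w' 4" and zz: "z 4 * z 4 = z' 4 * z' 4"
    using tr'[of 4 4] tr'[of 4 5] by (simp_all add: P5 P5')
  have "w i \<bullet> w j = w' i \<bullet> w' j" if "i \<in> {0,1,2,3,4}" "j \<in> {0,1,2,3,4}" for i j
    using that tr'[of i j] Pz[of i] Pz[of j] Pz'[of i] Pz'[of j] w45 by auto
  then obtain u where u: "cmod u = 1"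
    "(\<forall>i\<in>{0,1,2,3,4}. w' i = u * w i) \<or> (\<forall>i\<in>{0,1,2,3,4}. w' i = u * cnj (w i))"
    using planar_congruence[of "{0,1,2,3,4}" w w'] by metis
  \<comment> \<open>The matrix built from \<open>v\<close> acts on the plane through
    \<open>v\<^sup>2\<close>, so a square root of \<open>u\<close> is taken.\<close>
  define v where "v = csqrt u"
  have v: "cmod v = 1" "v\<^sup>2 = u"
    using u(1) by (simp_all add: v_def norm_csqrt)
  have z4: "z' 4 = z 4 \<or> z' 4 = - z 4"
    using zz by (auto simp: square_eq_iff)
  \<comment> \<open>The sign \<epsilon> stands for the determinant of \<open>Q\<close>. If
    \<open>Q\<close> gives \<open>z 4\<close> the wrong sign, the swap repairs it because
    \<open>z 5 = - z 4\<close>, while \<open>t\<close> and \<open>w\<close> agree at 4 and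
    5.\<close>
  have conj: "\<exists>\<pi>\<in>{id, swap45}. \<forall>i\<le>5. B' i = Q ** B (\<pi> i) ** matrix_inv Q"
    if Q: "\<And>t w z. Q ** mat_parts t w z ** matrix_inv Q = mat_parts t (h w) (\<epsilon> * z)"
      and h: "\<forall>i\<in>{0,1,2,3,4}. w' i = h (w i)" and \<epsilon>: "\<epsilon> \<in> {1, -1}" for Q h \<epsilon>
  proof -
    have "\<exists>\<pi>\<in>{id, swap45}. z' 4 = \<epsilon> * z (\<pi> 4)"
      using z4 \<epsilon> P5(3) by auto
    then obtain \<pi> where \<pi>: "\<pi> \<in> {id, swap45}" "z' 4 = \<epsilon> * z (\<pi> 4)" by blast
    have "t (\<pi> i) = t' i \<and> w' i = h (w (\<pi> i)) \<and> z' i = \<epsilon> * z (\<pi> i)" if "i < 6" for i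
      using that
    proof (cases rule: less_6_cases)
      case 5
      then show ?thesis using \<pi> h P5 t[of 4] by auto
    next
      case 6
      then show ?thesis using \<pi> h P5 P5' t[of 4] by auto
    qed (use \<pi> h t Pz Pz' in \<open>auto simp: Transposition.transpose_def\<close>)
    then show ?thesis using \<pi>(1) by (intro bexI[of _ \<pi>]) (auto simp: P P' Q)
  qed
  from u(2) show ?thesis
  proof
    assume "\<forall>i\<in>{0,1,2,3,4}. w' i = u * w i"
    then show ?thesis
      using rotation_conj_mat_parts[OF v(1)]
        conj[of "mat2 (Re v) (- Im v) (Im v) (Re v)" "\<lambda>w. u * w" 1] by (auto simp: v(2))
  next
    assume "\<forall>i\<in>{0,1,2,3,4}. w' i = u * cnj (w i)"
    then show ?thesis
      using reflection_conj_mat_parts[OF v(1)]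
        conj[of "mat2 (Re v) (Im v) (Im v) (- Re v)" "\<lambda>w. u * cnj w" "-1"] by (auto simp: v(2))
  qed
qed

section \<open>Existence\<close>

lemma triple_mul_assoc: "triple_mul (triple_mul x y) z = triple_mul x (triple_mul y z)"
  by (simp add: triple_mul_def split_beta matrix_mul_assoc)

lemma triple_one_mul: "triple_mul triple_one x = x" "triple_mul x triple_one = x"
  by (simp_all add: triple_mul_def triple_one_def split_beta)

lemma triple_star_mul: "triple_star (triple_mul x y) = triple_mul (triple_star y) (triple_star x)"
  by (simp add: triple_mul_def triple_star_def split_beta matrix_transpose_mul)

lemma triple_star_star: "triple_star (triple_star x) = x"
  by (simp add: triple_star_def split_beta)

text \<open>Reduces existence to solving the Gram relation in the coordinates \<open>t\<close>,
  \<open>w\<close>, \<open>z\<close>: its left side is the trace with weights \<open>a\<close>,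
  \<open>b\<close>, \<open>c\<close> applied to a product of two basis elements.\<close>

lemma rba_family_mat_partsI:
  fixes \<delta> \<phi> t z :: "nat \<Rightarrow> real" and w :: "nat \<Rightarrow> complex"
  assumes \<delta>: "\<And>i. i < 6 \<Longrightarrow> \<delta> i > 0" and ends: "\<delta> 0 = 1" "\<delta> 5 = \<delta> 4" "\<phi> 0 = 1" "\<phi> 5 = \<phi> 4"
    and t: "t 0 = 2" "t 5 = t 4" and w: "w 0 = 0" "w 5 = w 4"
    and z: "\<And>i. i \<in> {0,1,2,3} \<Longrightarrow> z i = 0" "z 5 = - z 4"
    and gram: "\<And>i j. \<lbrakk>i < 6; j < 6\<rbrakk> \<Longrightarrow> a * (\<delta> i * \<delta> j) + b * (\<phi> i * \<phi> j)
      + c * (t i * t j / 2 + 2 * (w i \<bullet> w j) - 2 * z i * z j) = (if j = swap45 i then \<delta> i else 0)"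
  shows "rba_family \<delta> \<phi> (\<lambda>i. mat_parts (t i) (w i) (z i))"
proof -
  let ?B = "\<lambda>i. mat_parts (t i) (w i) (z i)"
  let ?b = "\<lambda>i. (\<delta> i, \<phi> i, ?B i)"
  define \<tau> where "\<tau> = (\<lambda>(x, y, Z :: real^2^2). a * x + b * y + c * trace Z)"
  have \<tau>: "linear \<tau>"
    by (auto simp: \<tau>_def trace_add trace_scaleR algebra_simps intro!: linearI)
  have dim: "DIM(triple) = 6" by simp
  have "real_standard_rba_delta_basis triple_mul triple_one triple_star DIM(triple) ?b triple_deg"
  proof (rule real_standard_rba_delta_basisI[where \<tau> = \<tau> and \<sigma> = swap45, OF bilinear_triple_mul
        triple_mul_assoc triple_one_mul linear_triple_star triple_star_mul triple_star_star
        linear_triple_deg _ _ _ \<tau>], unfold dim)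
    show "triple_star (?b i) = ?b (swap45 i)" if "i < 6" for i
      using that
      by (cases rule: less_6_cases)
        (simp_all add: triple_star_def transpose_mat_parts z t w ends Transposition.transpose_def)
    show "\<tau> (triple_mul (?b i) (?b j)) = (if j = swap45 i then triple_deg (?b i) else 0)"
      if "i < 6" "j < 6" for i j
      using gram[OF that] by (simp add: \<tau>_def triple_mul_def triple_deg_def trace_mult_mat_parts)
  qed (use \<delta> in \<open>auto simp: triple_deg_def triple_mul_def triple_one_def triple_star_def ends t w z
        mat_1_mat_parts Transposition.transpose_def\<close>)
  moreover have "\<exists>r s u. ?B i = mat2 r s s u" if "i \<in> {1,2,3}" for i
    using that z(1)[of i] by (auto simp: mat_parts_def)
  ultimately show ?thesis
    unfolding rba_family_def dim
    by (auto simp: t w z mat_1_mat_parts transpose_mat_parts) (auto simp: mat_parts_def)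
qed

text \<open>Orthogonality to \<open>b 0\<close> forces
  \<open>t i = (- \<delta> i / n - \<phi> i / m) / c\<close> for \<open>i \<noteq> 0\<close>. The
  terms of the Gram relation without \<open>w\<close> and \<open>z\<close> then add up to the
  fraction of \<open>orthogonal_complement_of_pair\<close>, for vectors with squared lengths
  \<open>n - 1\<close>, \<open>m - 1\<close> and inner product -1.\<close>

lemma residual_gram_identity:
  fixes n m :: real
  assumes n: "n \<noteq> 0" and m: "m \<noteq> 0" and D: "(n - 1) * (m - 1) - 1 \<noteq> 0"
  defines "c \<equiv> (1 - 1/n - 1/m) / 2"
  shows "x * x' / n + y * y' / m + c * (((- x/n - y/m) / c) * ((- x'/n - y'/m) / c) / 2)
    = ((m - 1) * x * x' + (x * y' + y * x') + (n - 1) * y * y') / ((n - 1) * (m - 1) - 1)"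
proof -
  define D where "D = (n - 1) * (m - 1) - 1"
  have "D \<noteq> 0" using D by (simp add: D_def)
  have c: "c = D / (2 * n * m)"
    using n m by (simp add: c_def D_def field_simps)
  have "c * (((- x/n - y/m) / c) * ((- x'/n - y'/m) / c) / 2) = (x/n + y/m) * (x'/n + y'/m) * (n * m) / D"
    using n m \<open>D \<noteq> 0\<close> unfolding c by (simp add: field_simps)
  also have "\<dots> = (m * x + n * y) * (m * x' + n * y') / (n * m * D)"
    using n m \<open>D \<noteq> 0\<close> by (simp add: field_simps)
  also have "x * x' / n + y * y' / m + (m * x + n * y) * (m * x' + n * y') / (n * m * D)
      = (m * D * x * x' + n * D * y * y' + (m * x + n * y) * (m * x' + n * y')) / (n * m * D)"
    using n m \<open>D \<noteq> 0\<close> by (simp add: field_simps)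
  also have "m * D * x * x' + n * D * y * y' + (m * x + n * y) * (m * x' + n * y')
      = n * m * ((m - 1) * x * x' + (x * y' + y * x') + (n - 1) * y * y')"
    by (simp add: D_def algebra_simps)
  also have "\<dots> / (n * m * D) = ((m - 1) * x * x' + (x * y' + y * x') + (n - 1) * y * y') / D"
    using n m by simp
  finally show ?thesis by (simp add: D_def)
qed

text \<open>The normalized vectors of \<open>\<delta>\<close> and \<open>\<phi>\<close> on the indices \<open>1, 2, 3\<close> and the merged index
  \<open>{4, 5}\<close> span a plane in four-space. Coordinates in an orthonormal basis of its orthogonal
  complement are the traceless symmetric parts of the matrices.\<close>

lemma rba_family_exists:
  fixes \<delta> \<phi> :: "nat \<Rightarrow> real"
  assumes pos: "\<forall>i\<in>{1..4}. \<delta> i > 0"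
    and sum0: "1 + \<phi> 1 + \<phi> 2 + \<phi> 3 + 2 * \<phi> 4 = 0"
    and ends: "\<delta> 0 = 1" "\<delta> 5 = \<delta> 4" "\<phi> 0 = 1" "\<phi> 5 = \<phi> 4"
    and ratio: "\<exists>i\<in>{1,2,3}. \<phi> 4 / \<delta> 4 \<noteq> \<phi> i / \<delta> i"
  shows "\<exists>B. rba_family \<delta> \<phi> B"
proof -
  define n where "n = (\<Sum>i<6. \<delta> i)"
  define m where "m = (\<Sum>i<6. (\<phi> i)\<^sup>2 / \<delta> i)"
  define c where "c = (1 - 1/n - 1/m) / 2"
  have gap: "1 < (n - 1) * (m - 1)"
    unfolding n_def m_def using assms by (rule degree_multiplicity_gap)
  have \<delta>: "\<delta> 1 > 0" "\<delta> 2 > 0" "\<delta> 3 > 0" "\<delta> 4 > 0" using pos by auto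
  have \<delta>_pos: "\<delta> i > 0" if "i < 6" for i
    using that by (cases rule: less_6_cases) (use \<delta> ends in simp_all)
  have n1: "n - 1 = \<delta> 1 + \<delta> 2 + \<delta> 3 + 2 * \<delta> 4"
    by (simp add: n_def sum_less_6 ends)
  then have "n > 1" using \<delta> by linarith
  moreover from this gap have "m > 1"
    using mult_nonneg_nonpos[of "n - 1" "m - 1"] by linarith
  ultimately have nm: "n > 0" "m > 0" by simp_all
  \<comment> \<open>Clearing denominators turns the gap inequality into positivity of
    \<open>c\<close>, needed for the square roots below.\<close>
  have "2 * c * (n * m) = (n - 1) * (m - 1) - 1"
    using nm by (simp add: c_def field_simps)
  with gap nm have c: "c > 0"
    by (metis diff_gt_0_iff_gt mult_pos_pos zero_less_mult_pos2 zero_less_mult_pos zero_less_numeral)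
  \<comment> \<open>The fourth coordinate stands for 4 and 5 together. The choice
    \<open>\<delta> 4 / 2\<close>, with the factor 2 in \<open>a\<close>, gives it weight
    \<open>2 * \<delta> 4\<close> in \<open>a \<bullet> a\<close> and \<open>\<delta> 4\<close> in
    \<open>a \<bullet> e 4\<close>.\<close>
  define \<rho> where "\<rho> i = (if i = 4 then sqrt (\<delta> 4 / 2) else sqrt (\<delta> i))" for i
  have \<rho>: "\<rho> 1 > 0" "\<rho> 2 > 0" "\<rho> 3 > 0" "\<rho> 4 > 0"
    and \<rho>_sq: "\<rho> 1 * \<rho> 1 = \<delta> 1" "\<rho> 2 * \<rho> 2 = \<delta> 2" "\<rho> 3 * \<rho> 3 = \<delta> 3" "\<rho> 4 * \<rho> 4 = \<delta> 4 / 2"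
    using \<delta> by (simp_all add: \<rho>_def)
  define a where "a = (\<rho> 1, \<rho> 2, \<rho> 3, 2 * \<rho> 4)"
  define d where "d = (\<phi> 1 / \<rho> 1, \<phi> 2 / \<rho> 2, \<phi> 3 / \<rho> 3, \<phi> 4 / \<rho> 4)"
  have aa: "a \<bullet> a = n - 1"
    by (simp add: a_def n1 \<rho>_sq del: One_nat_def)
  have dd: "d \<bullet> d = m - 1"
    by (simp add: d_def m_def sum_less_6 ends \<rho>_sq power2_eq_square del: One_nat_def)
  have ad: "a \<bullet> d = - 1"
    using \<rho> sum0 by (simp add: a_def d_def del: One_nat_def)
  have dim: "DIM(real \<times> real \<times> real \<times> real) = 4" and gap': "(- 1)\<^sup>2 < (n - 1) * (m - 1)"
    using gap by simp_all
  obtain f g :: "real \<times> real \<times> real \<times> real" where fg: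
    "\<And>x y. (f \<bullet> x) * (f \<bullet> y) + (g \<bullet> x) * (g \<bullet> y) = x \<bullet> y -
       ((m - 1) * (a \<bullet> x) * (a \<bullet> y) - (- 1) * ((a \<bullet> x) * (d \<bullet> y) + (d \<bullet> x) * (a \<bullet> y))
         + (n - 1) * (d \<bullet> x) * (d \<bullet> y)) / ((n - 1) * (m - 1) - (- 1)\<^sup>2)"
    using orthogonal_complement_of_pair[of a d, unfolded aa dd ad, OF dim gap'] by blast
  \<comment> \<open>The last branch serves both 4 and 5; its value at 0 never enters, as
    \<open>w 0\<close> is set to 0 separately.\<close>
  define e where "e i = (if i = 1 then (\<rho> 1, 0, 0, 0) else if i = 2 then (0, \<rho> 2, 0, 0)
    else if i = 3 then (0, 0, \<rho> 3, 0) else (0, 0, 0, \<rho> 4))" for i :: nat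
  \<comment> \<open>The trace form gives inner products of the \<open>w i\<close> the weight
    \<open>2 * c\<close>, which the scaling offsets.\<close>
  define w where "w i = (if i = 0 then 0 else Complex (f \<bullet> e i) (g \<bullet> e i) /\<^sub>R sqrt (2 * c))" for i
  \<comment> \<open>Solves the requirement that the trace be 1 on \<open>b 0\<close> and 0 on the
    other basis elements.\<close>
  define t where "t i = ((if i = 0 then 1 else 0) - \<delta> i / n - \<phi> i / m) / c" for i
  \<comment> \<open>As \<open>e 4 \<bullet> e 4 = \<delta> 4 / 2\<close>, the skew term must
    contribute \<open>\<delta> 4 / 2\<close> in absolute value: it cancels in the pair (4,4) and
    doubles to \<open>\<delta> 4\<close> in (4,5).\<close>
  define z where "z i = (if i = 4 then 1 else if i = 5 then - 1 else 0) * sqrt (\<delta> 4 / (4 * c))" for i :: nat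
  have e_cases: "a \<bullet> e i = \<delta> i \<and> d \<bullet> e i = \<phi> i" if "i \<in> {1, 2, 3, 4, 5}" for i
    using that
    by (elim insertE emptyE)
      (use \<rho> in \<open>simp_all add: e_def a_def d_def \<rho>_sq ends mult.assoc del: One_nat_def\<close>)
  have e: "a \<bullet> e i = \<delta> i" "d \<bullet> e i = \<phi> i" if "i < 6" "i \<noteq> 0" for i
  proof -
    have "i \<in> {1, 2, 3, 4, 5}" using that by auto
    then show "a \<bullet> e i = \<delta> i" "d \<bullet> e i = \<phi> i" using e_cases by blast+
  qed
  have ww: "2 * c * (w i \<bullet> w j) = e i \<bullet> e j -
      ((m - 1) * \<delta> i * \<delta> j + (\<delta> i * \<phi> j + \<phi> i * \<delta> j) + (n - 1) * \<phi> i * \<phi> j) / ((n - 1) * (m - 1) - 1)"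
    if "i < 6" "j < 6" "i \<noteq> 0" "j \<noteq> 0" for i j
  proof -
    have "2 * c * (w i \<bullet> w j) = (f \<bullet> e i) * (f \<bullet> e j) + (g \<bullet> e i) * (g \<bullet> e j)"
      using that c by (simp add: w_def inner_complex_def field_simps)
    then show ?thesis
      unfolding fg using that by (simp add: e)
  qed
  have ez: "e i \<bullet> e j - 2 * c * (z i * z j) = (if j = swap45 i then \<delta> i else 0)"
    if i: "i < 6" "i \<noteq> 0" and j: "j < 6" "j \<noteq> 0" for i j
  proof -
    have "i \<in> {1,2,3,4,5}" "j \<in> {1,2,3,4,5}" using i j by auto
    moreover have "sqrt (\<delta> 4 / (4 * c)) * sqrt (\<delta> 4 / (4 * c)) = \<delta> 4 / (4 * c)"
      using \<delta> c by simp
    ultimately show ?thesis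
      using c by (auto simp: e_def z_def \<rho>_sq ends Transposition.transpose_def simp del: One_nat_def)
  qed
  have "t 0 = 2"
    using c by (simp add: t_def ends) (simp add: c_def field_simps)
  have "rba_family \<delta> \<phi> (\<lambda>i. mat_parts (t i) (w i) (z i))"
  proof (rule rba_family_mat_partsI[where a = "1/n" and b = "1/m" and c = c])
    fix i j :: nat assume ij: "i < 6" "j < 6"
    show "1/n * (\<delta> i * \<delta> j) + 1/m * (\<phi> i * \<phi> j)
      + c * (t i * t j / 2 + 2 * (w i \<bullet> w j) - 2 * z i * z j) = (if j = swap45 i then \<delta> i else 0)"
    proof (cases "i = 0 \<or> j = 0")
      case True
      have t_sum: "\<delta> k / n + \<phi> k / m + c * t k = (if k = 0 then 1 else 0)" for k
        using c by (simp add: t_def)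
      show ?thesis
        using True ij \<open>t 0 = 2\<close> t_sum[of i] t_sum[of j]
        by (auto simp: ends w_def z_def Transposition.transpose_def)
    next
      case False
      \<comment> \<open>This is exactly the fraction subtracted in \<open>ww\<close>, so only the
        terms of \<open>ez\<close> survive.\<close>
      have "1/n * (\<delta> i * \<delta> j) + 1/m * (\<phi> i * \<phi> j) + c * (t i * t j / 2)
        = ((m - 1) * \<delta> i * \<delta> j + (\<delta> i * \<phi> j + \<phi> i * \<delta> j) + (n - 1) * \<phi> i * \<phi> j) / ((n - 1) * (m - 1) - 1)"
        using residual_gram_identity[of n m "\<delta> i" "\<delta> j" "\<phi> i" "\<phi> j"] nm gap False
        by (simp add: t_def c_def)
      with ww[OF ij] ez[of i j] ij False show ?thesis
        by (simp add: algebra_simps)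
    qed
  qed (use \<delta>_pos ends \<open>t 0 = 2\<close> in \<open>auto simp: t_def w_def e_def z_def\<close>)
  then show ?thesis by blast
qed

theorem theorem3:
  fixes \<delta> \<phi> :: "nat \<Rightarrow> real"
  assumes "\<forall>i\<in>{1..4}. \<delta> i > 0"
    and "1 + \<phi> 1 + \<phi> 2 + \<phi> 3 + 2 * \<phi> 4 = 0"
    and "\<delta> 0 = 1" and "\<delta> 5 = \<delta> 4" and "\<phi> 0 = 1" and "\<phi> 5 = \<phi> 4"
    and "\<exists>i\<in>{1,2,3}. \<phi> 4 / \<delta> 4 \<noteq> \<phi> i / \<delta> i"
  shows "(\<exists>B. rba_family \<delta> \<phi> B) \<and>
    (\<forall>B B'. rba_family \<delta> \<phi> B \<and> rba_family \<delta> \<phi> B' \<longrightarrow>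
      (\<exists>Q \<pi>. orthogonal_matrix Q \<and> \<pi> \<in> index_perms \<and>
        (\<forall>i\<le>5. B' i = Q ** B (\<pi> i) ** matrix_inv Q)))"
proof (intro conjI allI impI)
  show "\<exists>B. rba_family \<delta> \<phi> B"
    using assms by (rule rba_family_exists)
next
  fix B B' assume fam: "rba_family \<delta> \<phi> B \<and> rba_family \<delta> \<phi> B'"
  let ?n = "\<Sum>i<6. \<delta> i" and ?m = "\<Sum>i<6. (\<phi> i)\<^sup>2 / \<delta> i"
  have \<delta>: "\<delta> i > 0" if "i < 6" for i
    using that by (cases rule: less_6_cases) (use assms(1,3,4) in simp_all)
  note gram = rba_family_gram[OF _ \<delta> assms(3-6)]
  have "1 < (?n - 1) * (?m - 1)"
    using assms by (rule degree_multiplicity_gap)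
  \<comment> \<open>For nonzero denominators, multiplying by \<open>?n * ?m\<close> gives
    \<open>(?n - 1) * (?m - 1) - 1\<close>. In the other case the default \<open>1 / 0 = 0\<close>
    applies, and the gap still excludes the value 0.\<close>
  then have "1 - 1/?n - 1/?m \<noteq> 0"
    by (cases "?n = 0 \<or> ?m = 0") (auto simp: field_simps)
  moreover have "(1 - 1/?n - 1/?m) / 2 * trace (B i ** B j) = (1 - 1/?n - 1/?m) / 2 * trace (B' i ** B' j)"
    if "i < 6" "j < 6" for i j
    using gram[of B i j] gram[of B' i j] fam that by linarith
  ultimately have "trace (B i ** B j) = trace (B' i ** B' j)" if "i < 6" "j < 6" for i j
    using that by simp
  then obtain Q \<pi> where "\<pi> \<in> {id, swap45}" "orthogonal_matrix Q"
      "\<forall>i\<le>5. B' i = Q ** B (\<pi> i) ** matrix_inv Q"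
    using orthogonally_conjugate_if_same_traces[of B B'] fam unfolding rba_family_def by blast
  then show "\<exists>Q \<pi>. orthogonal_matrix Q \<and> \<pi> \<in> index_perms \<and>
        (\<forall>i\<le>5. B' i = Q ** B (\<pi> i) ** matrix_inv Q)"
    using index_perms_id index_perms_swap45 by blast
qed

end
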